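(* Let $\mathbb F=\mathbb R$ or $\mathbb F=\mathbb C$ and $n\ge 1$. For every monic polynomial $p$ of degree $n$ over $\mathbb F$ there is an irreducible tridiagonal $n\times n$ matrix $A$ over $\mathbb F$ whose characteristic polynomial $\det(tI-A)$ equals $p(t)$ (and thus $A$ may have any eigenvalues, counting multiplicities, that are the roots of a monic polynomial over $\mathbb F$).
   Context: A (normalized) tridiagonal matrix over $\mathbb F$ is an $n\times n$ matrix $A$ with diagonal entries $a_1,\dots,a_n\in\mathbb F$, all superdiagonal entries (positions $(i,i+1)$) equal to $1$, subdiagonal entries (positions $(i+1,i)$) $b_1,\dots,b_{n-1}\in\mathbb F$, and all other entries $0$. It is irreducible if $b_i\neq 0$ for all $i=1,\dots,n-1$. *)

theory Defs
  imports "Jordan_Normal_Form.Char_Poly" Complex_Main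
begin

text \<open>Matrix indices start at \<open>0\<close>.\<close>

definition tridiagonal :: "nat \<Rightarrow> 'a :: comm_ring_1 mat \<Rightarrow> bool" where
  "tridiagonal n A \<longleftrightarrow>
     A \<in> carrier_mat n n \<and>
     (\<forall>i. Suc i < n \<longrightarrow> A $$ (i, Suc i) = 1) \<and>
     (\<forall>i<n. \<forall>j<n. i \<noteq> j \<and> j \<noteq> Suc i \<and> i \<noteq> Suc j \<longrightarrow> A $$ (i, j) = 0)"

definition irreducible_tridiagonal :: "nat \<Rightarrow> 'a :: comm_ring_1 mat \<Rightarrow> bool" where
  "irreducible_tridiagonal n A \<longleftrightarrow>
     tridiagonal n A \<and> (\<forall>i. Suc i < n \<longrightarrow> A $$ (Suc i, i) \<noteq> 0)"

definition algebraic_multiplicity :: "'a :: field mat \<Rightarrow> 'a \<Rightarrow> nat" where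
  "algebraic_multiplicity A z = order z (char_poly A)"

text \<open>The eigenvalues of \<open>A\<close>, counted with algebraic multiplicity, are the roots of \<open>p\<close>,
  counted with multiplicity. A real matrix has to be regarded as a complex one here,
  because real polynomials may have non-real roots.\<close>

definition eigenvalues_are_roots :: "complex mat \<Rightarrow> complex poly \<Rightarrow> bool" where
  "eigenvalues_are_roots A p \<longleftrightarrow>
     (\<forall>z. eigenvalue A z \<longleftrightarrow> poly p z = 0) \<and>
     (\<forall>z. algebraic_multiplicity A z = order z p)"

end

theory Submission
  imports Defs
begin

text \<open>
  Expanding along the last row shows that the characteristic polynomials \<open>K\<^sub>k\<close> of the leading blocks
  of a tridiagonal matrix satisfy \<open>K\<^sub>k\<^sub>+\<^sub>2 = (t - a\<^sub>k\<^sub>+\<^sub>1) K\<^sub>k\<^sub>+\<^sub>1 - b\<^sub>k K\<^sub>k\<close>. This is a Euclidean algorithm,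
  so a monic \<open>p\<close> of degree \<open>n\<close> is the characteristic polynomial of an irreducible tridiagonal matrix
  as soon as some monic \<open>q\<close> of degree \<open>n - 1\<close> has the property that every remainder in the Euclidean
  algorithm for \<open>(p, q)\<close>, down to a nonzero constant, has degree exactly one less than its
  predecessor. The proof finds such a
  \<open>q\<close> by deforming \<open>p\<close> to \<open>t\<^sup>n\<close>.

  \<^item> For \<open>p = t\<^sup>n\<close> there is an explicit matrix (\<open>char_poly_nilpotent_tridiagonal\<close>). It comes from the
    \<open>n\<close>-dimensional irreducible representation of \<open>sl\<^sub>2\<close>: conjugating the raising operator \<open>E\<close> by the
    exponential of the lowering operator gives a nilpotent matrix that is a combination of the raising,
    the weight and the lowering operator, hence tridiagonal, with weights on its diagonal.

  \<^item> The degrees of the remainders are stable under small perturbations of the two polynomials,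
    because the quotients and the leading coefficients of the remainders depend continuously on them
    (\<open>euclid_tridiagonal_perturbation\<close>). So every monic polynomial close enough to \<open>t\<^sup>n\<close> is the
    characteristic polynomial of an irreducible tridiagonal matrix.

  \<^item> For an arbitrary monic \<open>p\<close>, the polynomial \<open>e\<^sup>-\<^sup>n p(e t)\<close> tends to \<open>t\<^sup>n\<close> as \<open>e\<close> grows, and a
    matrix for it is turned into one for \<open>p\<close> by multiplying the diagonal by \<open>e\<close> and the subdiagonal
    by \<open>e\<^sup>2\<close> (\<open>char_poly_tridiagonal_scale\<close>).
\<close>

hide_const (open) Module.smult

section \<open>Determinants of tridiagonal matrices\<close>

definition tri_mat :: "(nat \<Rightarrow> 'a) \<Rightarrow> (nat \<Rightarrow> 'a) \<Rightarrow> (nat \<Rightarrow> 'a) \<Rightarrow> nat \<Rightarrow> 'a :: zero mat" where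
  "tri_mat d u l n = mat n n (\<lambda>(i, j).
     if i = j then d i else if j = Suc i then u i else if i = Suc j then l j else 0)"

lemma tri_mat_carrier [simp]: "tri_mat d u l n \<in> carrier_mat n n"
  by (simp add: tri_mat_def)

lemma tri_mat_dim [simp]: "dim_row (tri_mat d u l n) = n" "dim_col (tri_mat d u l n) = n"
  by (simp_all add: tri_mat_def)

lemma mat_delete_last_tri_mat: "mat_delete (tri_mat d u l (Suc n)) n n = tri_mat d u l n"
  by (rule eq_matI) (auto simp: tri_mat_def mat_delete_def)

lemma det_tri_mat_rec:
  fixes d :: "nat \<Rightarrow> 'a :: comm_ring_1"
  shows "det (tri_mat d u l (Suc (Suc n))) =
    d (Suc n) * det (tri_mat d u l (Suc n)) - u n * l n * det (tri_mat d u l n)"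
proof -
  let ?T = "tri_mat d u l (Suc (Suc n))"
  let ?B = "mat_delete ?T (Suc n) n"
  have B: "?B \<in> carrier_mat (Suc n) (Suc n)"
    using mat_delete_carrier[of ?T "Suc (Suc n)" "Suc (Suc n)" "Suc n" n] by simp
  have B_del: "mat_delete ?B n n = tri_mat d u l n"
    by (rule eq_matI) (auto simp: tri_mat_def mat_delete_def)
  \<comment> \<open>Besides its diagonal entry, the last row of \<open>T\<close> has only \<open>l n\<close>; deleting the row and the column of
    \<open>l n\<close> leaves a matrix whose last column has only the entry \<open>u n\<close>, at the bottom.\<close>
  have "det ?B = (\<Sum>i<Suc n. ?B $$ (i, n) * cofactor ?B i n)"
    by (rule laplace_expansion_column[OF B]) simp
  also have "\<dots> = ?B $$ (n, n) * cofactor ?B n n"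
  proof -
    have "?B $$ (i, n) = 0" if "i < n" for i
      using that by (auto simp: tri_mat_def mat_delete_def)
    then show ?thesis by simp
  qed
  also have "\<dots> = u n * det (tri_mat d u l n)"
    unfolding cofactor_def B_del by (simp add: tri_mat_def mat_delete_def)
  finally have det_B: "det ?B = u n * det (tri_mat d u l n)" .
  have "det ?T = (\<Sum>j<Suc (Suc n). ?T $$ (Suc n, j) * cofactor ?T (Suc n) j)"
    by (rule laplace_expansion_row[OF tri_mat_carrier]) simp
  also have "\<dots> = ?T $$ (Suc n, n) * cofactor ?T (Suc n) n
      + ?T $$ (Suc n, Suc n) * cofactor ?T (Suc n) (Suc n)"
  proof -
    have "?T $$ (Suc n, j) = 0" if "j < n" for j
      using that by (auto simp: tri_mat_def)
    then show ?thesis by simp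
  qed
  also have "?T $$ (Suc n, n) = l n" by (simp add: tri_mat_def)
  also have "?T $$ (Suc n, Suc n) = d (Suc n)" by (simp add: tri_mat_def)
  finally show ?thesis
    by (simp add: cofactor_def mat_delete_last_tri_mat det_B)
qed

definition jacobi_poly :: "(nat \<Rightarrow> 'a) \<Rightarrow> (nat \<Rightarrow> 'a) \<Rightarrow> nat \<Rightarrow> 'a :: comm_ring_1 poly" where
  "jacobi_poly a b n = char_poly (tri_mat a (\<lambda>_. 1) b n)"

lemma jacobi_poly_eq_det:
  "jacobi_poly a b n = det (tri_mat (\<lambda>i. [:- a i, 1:]) (\<lambda>_. - 1) (\<lambda>i. [:- b i:]) n)"
proof -
  have "char_poly_matrix (tri_mat a (\<lambda>_. 1) b n) =
      tri_mat (\<lambda>i. [:- a i, 1:]) (\<lambda>_. - 1) (\<lambda>i. [:- b i:]) n"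
    by (rule eq_matI) (auto simp: char_poly_matrix_def tri_mat_def one_pCons)
  then show ?thesis by (simp add: jacobi_poly_def char_poly_def)
qed

lemma degree_jacobi_poly [simp]: "degree (jacobi_poly a b n) = n"
  and coeff_jacobi_poly_lead [simp]: "coeff (jacobi_poly a b n) n = 1"
  using degree_monic_char_poly[OF tri_mat_carrier, of a "\<lambda>_. 1" b n]
  by (simp_all add: jacobi_poly_def)

lemma jacobi_poly_0 [simp]: "jacobi_poly a b 0 = 1"
  by (simp add: jacobi_poly_eq_det)

lemma jacobi_poly_1 [simp]: "jacobi_poly a b (Suc 0) = [:- a 0, 1:]"
  by (simp add: jacobi_poly_eq_det det_single tri_mat_def)

lemma jacobi_poly_rec:
  "jacobi_poly a b (Suc (Suc n)) =
     [:- a (Suc n), 1:] * jacobi_poly a b (Suc n) - smult (b n) (jacobi_poly a b n)"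
  by (simp add: jacobi_poly_eq_det det_tri_mat_rec)

lemma jacobi_poly_cong:
  assumes "\<And>k. k < n \<Longrightarrow> a k = a' k" "\<And>k. Suc k < n \<Longrightarrow> b k = b' k"
  shows "jacobi_poly a b n = jacobi_poly a' b' n"
proof -
  have "tri_mat a (\<lambda>_. 1) b n = tri_mat a' (\<lambda>_. 1) b' n"
    by (rule eq_matI) (auto simp: tri_mat_def assms)
  then show ?thesis by (simp add: jacobi_poly_def)
qed

text \<open>For invertible \<open>e\<close>, the scaled matrix is diagonally similar to \<open>e\<close> times the original one: the
  conjugation that restores the ones above the diagonal puts a second factor \<open>e\<close> below it. The
  composition with \<open>e t\<close> states this for the characteristic polynomials without dividing by \<open>e\<close>.\<close>

lemma char_poly_tridiagonal_scale:
  fixes e :: "'a :: comm_ring_1"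
  shows "jacobi_poly (\<lambda>i. e * a i) (\<lambda>i. e^2 * b i) n \<circ>\<^sub>p [:0, e:] = smult (e ^ n) (jacobi_poly a b n)"
proof (induction n rule: induct_nat_012)
  case (ge2 n)
  show ?case
    unfolding jacobi_poly_rec pcompose_diff pcompose_mult pcompose_smult ge2.IH
    by (simp add: pcompose_pCons smult_diff_right smult_add_right algebra_simps power2_eq_square)
qed (simp_all add: pcompose_pCons)

section \<open>A nilpotent irreducible tridiagonal matrix\<close>

text \<open>In closed form, \<open>laguerre_like k c\<close> is the sum of \<open>(-1)\<^sup>j (k choose j) c (c+1) \<dots> (c+j-1) t\<^sup>k\<^sup>-\<^sup>j\<close>
  over \<open>j\<close>.\<close>

fun laguerre_like :: "nat \<Rightarrow> 'a \<Rightarrow> 'a :: comm_ring_1 poly" where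
  "laguerre_like 0 c = 1"
| "laguerre_like (Suc k) c = [:0, 1:] * laguerre_like k c - smult c (laguerre_like k (c + 1))"

text \<open>In closed form this is termwise: the rising factorial \<open>c (c+1) \<dots> (c+j-1)\<close> has the forward difference
  \<open>j (c+1) \<dots> (c+j-1)\<close> in \<open>c\<close>, and \<open>j (k+1 choose j) = (k+1) (k choose j-1)\<close>.\<close>

lemma laguerre_like_diff:
  "laguerre_like (Suc k) (c + 1) - laguerre_like (Suc k) c =
     smult (- of_nat (Suc k)) (laguerre_like k (c + 1))"
proof (induction k arbitrary: c)
  case (Suc k)
  let ?L = laguerre_like
  have "?L (Suc (Suc k)) (c + 1) - ?L (Suc (Suc k)) c =
      [:0, 1:] * (?L (Suc k) (c + 1) - ?L (Suc k) c)
      - smult (c + 1) (?L (Suc k) (c + 1 + 1) - ?L (Suc k) (c + 1)) - ?L (Suc k) (c + 1)"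
    unfolding laguerre_like.simps(2)[of "Suc k"]
    by (simp del: laguerre_like.simps mult_pCons_left
        add: algebra_simps smult_add_left smult_diff_right)
  also have "\<dots> = smult (- of_nat (Suc k))
      ([:0, 1:] * ?L k (c + 1) - smult (c + 1) (?L k (c + 1 + 1))) - ?L (Suc k) (c + 1)"
    unfolding Suc.IH
    by (simp only: smult_smult mult_smult_right smult_diff_right mult.commute)
  also have "\<dots> = smult (- of_nat (Suc (Suc k))) (?L (Suc k) (c + 1))"
    unfolding laguerre_like.simps(2)[of k, symmetric] of_nat_Suc[of "Suc k"]
    by (simp del: laguerre_like.simps of_nat_Suc add: smult_add_left smult_diff_left)
  finally show ?case .
qed simp

text \<open>The parameter goes down as the degree goes up, which matches \<open>c = n - k\<close> for the \<open>k\<close>-th block of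
  an \<open>n\<close>-row matrix. Then the recurrence has exactly the form of \<open>jacobi_poly_rec\<close>.\<close>

lemma laguerre_like_rec:
  "laguerre_like (Suc (Suc k)) (c - 1) =
     [:of_nat (k + 2) - c, 1:] * laguerre_like (Suc k) c
       + smult (of_nat (k + 1) * c) (laguerre_like k (c + 1))"
proof -
  let ?L = laguerre_like
  have "?L (Suc (Suc k)) (c - 1) =
      ?L (Suc (Suc k)) c + smult (of_nat (k + 2)) (?L (Suc k) c)"
    using laguerre_like_diff[of "Suc k" "c - 1"]
    by (simp del: laguerre_like.simps of_nat_Suc add: diff_eq_eq)
  also have "?L (Suc (Suc k)) c = [:0, 1:] * ?L (Suc k) c - smult c (?L (Suc k) (c + 1))"
    by (rule laguerre_like.simps)
  also have "?L (Suc k) (c + 1) = ?L (Suc k) c - smult (of_nat (k + 1)) (?L k (c + 1))"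
    using laguerre_like_diff[of k c]
    by (simp del: laguerre_like.simps of_nat_Suc add: diff_eq_eq)
  finally show ?thesis
    by (simp del: laguerre_like.simps add: smult_add_left smult_diff_left smult_add_right
        smult_diff_right algebra_simps)
qed

lemma laguerre_like_zero: "laguerre_like k 0 = monom 1 k"
  by (induction k) (simp_all add: monom_Suc)

text \<open>These are the entries of \<open>E + H - F\<close>, where \<open>E\<close> has ones above the diagonal, \<open>F\<close> has the entries
  \<open>(k + 1) (n - k - 1)\<close> below it, and \<open>H\<close> is their commutator, with diagonal \<open>n - 1 - 2 k\<close>.\<close>

definition nil_diag :: "nat \<Rightarrow> nat \<Rightarrow> 'a :: comm_ring_1" where
  "nil_diag n k = of_nat n - 1 - 2 * of_nat k"

definition nil_sub :: "nat \<Rightarrow> nat \<Rightarrow> 'a :: comm_ring_1" where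
  "nil_sub n k = - of_nat (Suc k) * (of_nat n - of_nat (Suc k))"

lemma jacobi_poly_nil:
  "jacobi_poly (nil_diag n) (nil_sub n) k = laguerre_like k (of_nat n - of_nat k)"
proof (induction k rule: induct_nat_012)
  case (ge2 k)
  have "laguerre_like (Suc (Suc k)) (of_nat n - of_nat (Suc (Suc k))) =
      laguerre_like (Suc (Suc k)) ((of_nat n - of_nat (Suc k)) - 1 :: 'a)"
    by (simp del: laguerre_like.simps add: algebra_simps)
  also have "\<dots> = [:of_nat (k + 2) - (of_nat n - of_nat (Suc k)), 1:]
        * laguerre_like (Suc k) (of_nat n - of_nat (Suc k))
      + smult (of_nat (k + 1) * (of_nat n - of_nat (Suc k)))
          (laguerre_like k ((of_nat n - of_nat (Suc k)) + 1))"
    by (rule laguerre_like_rec)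
  also have "of_nat (k + 2) - (of_nat n - of_nat (Suc k)) = - (nil_diag n (Suc k) :: 'a)"
    by (simp add: nil_diag_def)
  also have "of_nat (k + 1) * (of_nat n - of_nat (Suc k)) = - (nil_sub n k :: 'a)"
    by (simp add: nil_sub_def algebra_simps)
  also have "(of_nat n - of_nat (Suc k)) + 1 = (of_nat n - of_nat k :: 'a)"
    by simp
  finally show ?case
    unfolding jacobi_poly_rec ge2.IH by (simp del: laguerre_like.simps)
qed (simp_all add: nil_diag_def)

text \<open>At \<open>k = n\<close> the parameter \<open>n - k\<close> vanishes, and with it every term except the leading one.\<close>

lemma char_poly_nilpotent_tridiagonal:
  "jacobi_poly (nil_diag n) (nil_sub n) n = monom 1 n"
  by (simp add: jacobi_poly_nil laguerre_like_zero)

lemma nil_sub_nonzero: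
  assumes "Suc k < n"
  shows "nil_sub n k \<noteq> (0 :: 'a :: {idom, ring_char_0})"
  using assms unfolding nil_sub_def mult_eq_0_iff neg_equal_0_iff_equal right_minus_eq of_nat_eq_iff
  by (auto simp del: of_nat_Suc)

section \<open>Stability of the Euclidean algorithm\<close>

text \<open>A division step replaces the pair \<open>(P, Q)\<close> by \<open>(Q, S)\<close>, where \<open>S\<close> is the normalized remainder.
  In the limit, the remainder has leading coefficient \<open>b n\<close>. As this is nonzero, the perturbed
  remainder has the same degree, and \<open>S\<close> converges to the next polynomial of the limit sequence.\<close>

lemma euclid_tridiagonal_perturbation:
  fixes P Q :: "'x \<Rightarrow> 'a :: real_normed_field poly"
  assumes "\<And>k. k < n \<Longrightarrow> b k \<noteq> 0"
    and "\<forall>\<^sub>F x in F. monic (P x) \<and> degree (P x) = Suc n"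
    and "\<forall>\<^sub>F x in F. monic (Q x) \<and> degree (Q x) = n"
    and "\<And>i. ((\<lambda>x. coeff (P x) i) \<longlongrightarrow> coeff (jacobi_poly a b (Suc n)) i) F"
    and "\<And>i. ((\<lambda>x. coeff (Q x) i) \<longlongrightarrow> coeff (jacobi_poly a b n) i) F"
  shows "\<forall>\<^sub>F x in F. \<exists>a' b'. (\<forall>k<n. b' k \<noteq> 0) \<and>
           P x = jacobi_poly a' b' (Suc n) \<and> Q x = jacobi_poly a' b' n"
  using assms
proof (induction n arbitrary: P Q)
  case 0
  show ?case using "0.prems"(2,3)
  proof eventually_elim
    case (elim x)
    have "Q x = 1" using elim(2) by (metis monic_degree_0)
    moreover have "P x = [:- (- coeff (P x) 0), 1:]"
      using elim(1) by (intro poly_eqI) (auto simp: coeff_pCons coeff_eq_0 split: nat.splits)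
    ultimately show ?case
      by (intro exI[of _ "\<lambda>_. - coeff (P x) 0"]) simp
  qed
next
  case (Suc n)
  \<comment> \<open>This choice of \<open>A x\<close> makes the two top coefficients of \<open>R x\<close> vanish.\<close>
  define A where "A x = coeff (Q x) n - coeff (P x) (Suc n)" for x
  define R where "R x = [:- A x, 1:] * Q x - P x" for x
  define B where "B x = coeff (R x) n" for x
  define S where "S x = smult (1 / B x) (R x)" for x
  have bn: "b n \<noteq> 0" by (rule Suc.prems(1)) simp
  have a_eq: "coeff (jacobi_poly a b (Suc n)) n - coeff (jacobi_poly a b (Suc (Suc n))) (Suc n)
      = a (Suc n)"
    by (simp add: jacobi_poly_rec coeff_eq_0)
  have A_lim: "(A \<longlongrightarrow> a (Suc n)) F"
    unfolding A_def a_eq[symmetric] by (intro tendsto_diff Suc.prems)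
  have shift_lim: "((\<lambda>x. coeff (pCons 0 (Q x)) i) \<longlongrightarrow> coeff (pCons 0 (jacobi_poly a b (Suc n))) i) F"
    for i
    using Suc.prems(5) by (cases i) simp_all
  have R_lim: "((\<lambda>x. coeff (R x) i) \<longlongrightarrow> b n * coeff (jacobi_poly a b n) i) F" for i
  proof -
    have "b n * coeff (jacobi_poly a b n) i =
        - a (Suc n) * coeff (jacobi_poly a b (Suc n)) i
        + coeff (pCons 0 (jacobi_poly a b (Suc n))) i - coeff (jacobi_poly a b (Suc (Suc n))) i"
      by (simp add: jacobi_poly_rec)
    moreover have "(\<lambda>x. coeff (R x) i) =
        (\<lambda>x. - A x * coeff (Q x) i + coeff (pCons 0 (Q x)) i - coeff (P x) i)"
      by (simp add: R_def)
    ultimately show ?thesis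
      by (auto intro!: tendsto_intros A_lim shift_lim Suc.prems(4,5))
  qed
  have B_lim: "(B \<longlongrightarrow> b n) F"
    using R_lim[of n] by (simp add: B_def[abs_def])
  have B_nz: "\<forall>\<^sub>F x in F. B x \<noteq> 0"
    using tendsto_imp_eventually_ne[OF B_lim bn] .
  have S_lim: "((\<lambda>x. coeff (S x) i) \<longlongrightarrow> coeff (jacobi_poly a b n) i) F" for i
  proof -
    have "((\<lambda>x. 1 / B x * coeff (R x) i) \<longlongrightarrow> 1 / b n * (b n * coeff (jacobi_poly a b n) i)) F"
      by (intro tendsto_intros B_lim R_lim bn)
    then show ?thesis using bn by (simp add: S_def)
  qed
  have S_monic: "\<forall>\<^sub>F x in F. monic (S x) \<and> degree (S x) = n"
    using Suc.prems(2,3) B_nz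
  proof eventually_elim
    case (elim x)
    have "coeff (R x) i = 0" if gt: "i > n" for i
    proof -
      obtain j where i: "i = Suc j" using gt by (cases i) auto
      with gt consider "j = n" | "j = Suc n" | "j > Suc n" by linarith
      then show ?thesis
        using elim by cases (auto simp: i R_def A_def coeff_eq_0)
    qed
    then have "degree (R x) \<le> n" by (intro degree_le) auto
    moreover have "n \<le> degree (R x)"
      using elim(3) by (intro le_degree) (simp add: B_def)
    ultimately show ?case using elim(3) by (simp add: S_def B_def)
  qed
  have "\<forall>\<^sub>F x in F. \<exists>a' b'. (\<forall>k<n. b' k \<noteq> 0) \<and>
      Q x = jacobi_poly a' b' (Suc n) \<and> S x = jacobi_poly a' b' n"
    using Suc.prems S_monic S_lim by (intro Suc.IH) auto
  then show ?case using B_nz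
  proof eventually_elim
    case (elim x)
    then obtain a' b' where b': "\<forall>k<n. b' k \<noteq> 0"
      and Q: "Q x = jacobi_poly a' b' (Suc n)" and S: "S x = jacobi_poly a' b' n"
      by blast
    let ?a = "a'(Suc n := A x)" and ?b = "b'(n := B x)"
    have Q': "jacobi_poly ?a ?b (Suc n) = Q x"
      unfolding Q by (rule jacobi_poly_cong) auto
    have S': "jacobi_poly ?a ?b n = S x"
      unfolding S by (rule jacobi_poly_cong) auto
    have "smult (B x) (S x) = R x" using elim(2) by (simp add: S_def)
    then have "P x = [:- A x, 1:] * Q x - smult (B x) (S x)" by (simp add: R_def)
    also have "\<dots> = jacobi_poly ?a ?b (Suc (Suc n))"
      unfolding jacobi_poly_rec Q' S' by simp
    finally have "P x = jacobi_poly ?a ?b (Suc (Suc n))" .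
    moreover have "\<forall>k<Suc n. ?b k \<noteq> 0" using b' elim(2) by auto
    ultimately show ?case using Q' by metis
  qed
qed

section \<open>Every monic polynomial\<close>

lemma monic_eq_jacobi_poly:
  fixes p :: "'a :: real_normed_field poly"
  assumes "monic p" "degree p = Suc m"
  obtains a b where "p = jacobi_poly a b (Suc m)" "\<And>k. k < m \<Longrightarrow> b k \<noteq> 0"
proof -
  let ?n = "Suc m"
  define e where "e N = (of_nat (Suc N) :: 'a)" for N
  define P where "P N = smult (1 / e N ^ ?n) (p \<circ>\<^sub>p [:0, e N:])" for N
  have e_nz: "e N \<noteq> 0" for N
    unfolding e_def of_nat_eq_0_iff by simp
  have inv_lim: "(\<lambda>N. 1 / e N) \<longlonglongrightarrow> 0"
    unfolding e_def using LIMSEQ_Suc[OF lim_inverse_n] by (simp only: inverse_eq_divide)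
  have P_coeff: "coeff (P N) i = (1 / e N) ^ (?n - i) * coeff p i" for N i
  proof (cases "i \<le> ?n")
    case True
    then have "e N ^ ?n = e N ^ i * e N ^ (?n - i)" by (simp flip: power_add del: power_Suc)
    then show ?thesis
      using e_nz by (simp add: P_def coeff_pcompose_linear power_one_over divide_simps del: power_Suc)
  next
    case False
    then show ?thesis using assms by (simp add: P_def coeff_pcompose_linear coeff_eq_0)
  qed
  have P_lead: "coeff (P N) ?n = 1" for N
    using assms by (simp add: P_coeff)
  have P_degree: "degree (P N) = ?n" for N
  proof (rule antisym)
    show "degree (P N) \<le> ?n" by (intro degree_le) (auto simp: P_coeff coeff_eq_0 assms)
    show "?n \<le> degree (P N)" by (rule le_degree) (simp add: P_lead)
  qed
  have P_lim: "(\<lambda>N. coeff (P N) i) \<longlonglongrightarrow> coeff (jacobi_poly (nil_diag ?n) (nil_sub ?n) ?n) i" for i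
  proof -
    have "(\<lambda>N. (1 / e N) ^ (?n - i) * coeff p i) \<longlonglongrightarrow> 0 ^ (?n - i) * coeff p i"
      by (intro tendsto_intros inv_lim)
    moreover have "0 ^ (?n - i) * coeff p i = coeff (monom 1 ?n) i"
    proof (cases i ?n rule: linorder_cases)
      case equal
      then show ?thesis using assms by simp
    next
      case greater
      then show ?thesis using assms by (simp add: coeff_eq_0)
    qed simp
    ultimately show ?thesis unfolding P_coeff char_poly_nilpotent_tridiagonal by simp
  qed
  \<comment> \<open>The second polynomial stays constant: the one that works for \<open>t\<^sup>n\<close> also works for all \<open>P N\<close> with
    large \<open>N\<close>.\<close>
  have "\<forall>\<^sub>F N in sequentially. \<exists>a b. (\<forall>k<m. b k \<noteq> 0) \<and> P N = jacobi_poly a b (Suc m) \<and>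
      jacobi_poly (nil_diag ?n) (nil_sub ?n) m = jacobi_poly a b m"
    by (rule euclid_tridiagonal_perturbation[where b = "nil_sub ?n" and a = "nil_diag ?n"])
      (use P_lim in \<open>simp_all add: nil_sub_nonzero P_degree P_lead\<close>)
  from eventually_happens'[OF sequentially_bot this]
  obtain N a b where b: "\<forall>k<m. b k \<noteq> 0" and P: "P N = jacobi_poly a b ?n"
    by blast
  let ?a = "\<lambda>i. e N * a i" and ?b = "\<lambda>i. (e N)^2 * b i"
  have comp: "p \<circ>\<^sub>p [:0, e N:] = jacobi_poly ?a ?b ?n \<circ>\<^sub>p [:0, e N:]"
    unfolding char_poly_tridiagonal_scale P[symmetric] P_def using e_nz[of N] by simp
  have "p = jacobi_poly ?a ?b ?n"
  proof (rule poly_eqI)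
    fix i
    have "e N ^ i * coeff p i = e N ^ i * coeff (jacobi_poly ?a ?b ?n) i"
      unfolding coeff_pcompose_linear[symmetric] comp ..
    then show "coeff p i = coeff (jacobi_poly ?a ?b ?n) i" using e_nz[of N] by simp
  qed
  moreover have "\<And>k. k < m \<Longrightarrow> ?b k \<noteq> 0" using b e_nz[of N] by simp
  ultimately show ?thesis by (rule that)
qed

lemma exists_irreducible_tridiagonal:
  fixes p :: "'a :: real_normed_field poly"
  assumes "monic p" "degree p = n" "n \<ge> 1"
  shows "\<exists>A :: 'a mat. irreducible_tridiagonal n A \<and> char_poly A = p"
proof -
  obtain m where n: "n = Suc m" using assms by (cases n) auto
  obtain a b where p: "p = jacobi_poly a b n" and b: "\<And>k. k < m \<Longrightarrow> b k \<noteq> 0"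
    using monic_eq_jacobi_poly assms unfolding n by metis
  have "irreducible_tridiagonal n (tri_mat a (\<lambda>_. 1) b n)"
    using b by (auto simp: irreducible_tridiagonal_def tridiagonal_def tri_mat_def n)
  then show ?thesis using p by (auto simp: jacobi_poly_def)
qed

lemma eigenvalues_are_roots_char_poly:
  assumes "A \<in> carrier_mat n n"
  shows "eigenvalues_are_roots A (char_poly A)"
  by (simp add: eigenvalues_are_roots_def algebraic_multiplicity_def eigenvalue_root_char_poly[OF assms])

theorem corollary3:
  fixes n :: nat
  assumes "n \<ge> 1"
  shows "(\<forall>p :: real poly. monic p \<and> degree p = n \<longrightarrow>
            (\<exists>A :: real mat. irreducible_tridiagonal n A \<and> char_poly A = p \<and>
               eigenvalues_are_roots (map_mat complex_of_real A) (map_poly complex_of_real p)))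
       \<and> (\<forall>p :: complex poly. monic p \<and> degree p = n \<longrightarrow>
            (\<exists>A :: complex mat. irreducible_tridiagonal n A \<and> char_poly A = p \<and>
               eigenvalues_are_roots A p))"
proof (intro conjI allI impI)
  fix p :: "real poly" assume "monic p \<and> degree p = n"
  then obtain A :: "real mat" where A: "irreducible_tridiagonal n A" "char_poly A = p"
    using exists_irreducible_tridiagonal assms by blast
  then have carrier: "A \<in> carrier_mat n n"
    by (simp add: irreducible_tridiagonal_def tridiagonal_def)
  have "char_poly (map_mat complex_of_real A) = map_poly complex_of_real p"
    using of_real_hom.char_poly_hom[OF carrier] A(2) by simp
  then have "eigenvalues_are_roots (map_mat complex_of_real A) (map_poly complex_of_real p)"
    using eigenvalues_are_roots_char_poly[of "map_mat complex_of_real A" n] carrier by simp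
  with A show "\<exists>A :: real mat. irreducible_tridiagonal n A \<and> char_poly A = p \<and>
      eigenvalues_are_roots (map_mat complex_of_real A) (map_poly complex_of_real p)"
    by blast
next
  fix p :: "complex poly" assume "monic p \<and> degree p = n"
  then obtain A :: "complex mat" where A: "irreducible_tridiagonal n A" "char_poly A = p"
    using exists_irreducible_tridiagonal assms by blast
  then have "A \<in> carrier_mat n n"
    by (simp add: irreducible_tridiagonal_def tridiagonal_def)
  then have "eigenvalues_are_roots A p"
    using eigenvalues_are_roots_char_poly A(2) by blast
  with A show "\<exists>A :: complex mat. irreducible_tridiagonal n A \<and> char_poly A = p \<and>
      eigenvalues_are_roots A p"
    by blast
qed

end
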